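(* $\pi(\vec T_3,5/3)=1$.
   Context: A partially directed $3$-graph ($3$-PDG) on a vertex set $V$ specifies for each $3$-subset $S\subseteq V$ exactly one of: no edge on $S$; an undirected edge on $S$; or a directed edge on $S$ directed toward a chosen vertex of $S$. For an $n$-vertex $3$-PDG $\vec H$, $\alpha(\vec H)=e_u(\vec H)/\binom n3$ and $\beta(\vec H)=e_d(\vec H)/\binom n3$, with $e_u,e_d$ the numbers of undirected and directed edges. $\vec F$ is a subgraph of $\vec H$ if a $3$-PDG isomorphic to $\vec F$ can be obtained from $\vec H$ by deleting edges, deleting vertices and forgetting directions of edges; $\vec H$ is $\vec F$-free otherwise. $\vec T_3$ is the $3$-PDG on $\{1,2,3,4\}$ with undirected edges $\{1,2,3\}$, $\{2,3,4\}$ and the edge $\{1,2,4\}$ directed toward $4$. $\pi(\vec F,\theta)$ is the smallest real number such that every $n$-vertex $\vec F$-free $3$-PDG $\vec H$ satisfies $\alpha(\vec H)+\theta\beta(\vec H)\le\pi(\vec F,\theta)+o_{n\to\infty}(1)$. *)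

theory Defs
  imports Complex_Main
begin

datatype 'a edge_status = NoEdge | Undirected | Directed 'a

text \<open>
  The field \<open>status\<close> is only meaningful on the 3-subsets of \<open>verts\<close>; its values on all other
  sets are ignored by every notion below.
\<close>

record 'a pdg3 =
  verts :: "'a set"
  status :: "'a set \<Rightarrow> 'a edge_status"

definition triples :: "'a pdg3 \<Rightarrow> 'a set set" where
  "triples H = {S. S \<subseteq> verts H \<and> card S = 3}"

definition is_pdg3 :: "'a pdg3 \<Rightarrow> bool" where
  "is_pdg3 H \<longleftrightarrow> finite (verts H) \<and> (\<forall>S\<in>triples H. \<forall>v. status H S = Directed v \<longrightarrow> v \<in> S)"

definition undirected_edges :: "'a pdg3 \<Rightarrow> 'a set set" where
  "undirected_edges H = {S \<in> triples H. status H S = Undirected}"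

definition directed_edges :: "'a pdg3 \<Rightarrow> 'a set set" where
  "directed_edges H = {S \<in> triples H. \<exists>v. status H S = Directed v}"

definition undirected_density :: "'a pdg3 \<Rightarrow> real" where
  "undirected_density H = real (card (undirected_edges H)) / real (card (verts H) choose 3)"

definition directed_density :: "'a pdg3 \<Rightarrow> real" where
  "directed_density H = real (card (directed_edges H)) / real (card (verts H) choose 3)"

definition pdg3_iso :: "'a pdg3 \<Rightarrow> 'b pdg3 \<Rightarrow> bool" where
  "pdg3_iso F G \<longleftrightarrow>
     (\<exists>f. bij_betw f (verts F) (verts G) \<and>
          (\<forall>S\<in>triples F. status G (f ` S) = map_edge_status f (status F S)))"

definition delete_vertices :: "'a set \<Rightarrow> 'a pdg3 \<Rightarrow> 'a pdg3" where
  "delete_vertices X H = H\<lparr>verts := verts H - X\<rparr>"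

definition delete_edges :: "'a set set \<Rightarrow> 'a pdg3 \<Rightarrow> 'a pdg3" where
  "delete_edges A H = H\<lparr>status := (\<lambda>S. if S \<in> A then NoEdge else status H S)\<rparr>"

definition forget_directions :: "'a set set \<Rightarrow> 'a pdg3 \<Rightarrow> 'a pdg3" where
  "forget_directions B H =
     H\<lparr>status := (\<lambda>S. case status H S of
         Directed v \<Rightarrow> (if S \<in> B then Undirected else Directed v)
       | s \<Rightarrow> s)\<rparr>"

text \<open>
  Any sequence of deletions and forgettings, in any order, can be rearranged into the order used here.
\<close>

definition pdg3_subgraph :: "'a pdg3 \<Rightarrow> 'b pdg3 \<Rightarrow> bool" where
  "pdg3_subgraph F H \<longleftrightarrow>
     (\<exists>X A B. pdg3_iso F (forget_directions B (delete_edges A (delete_vertices X H))))"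

definition pdg3_free :: "'a pdg3 \<Rightarrow> 'b pdg3 \<Rightarrow> bool" where
  "pdg3_free F H \<longleftrightarrow> \<not> pdg3_subgraph F H"

text \<open>
  The function \<open>\<epsilon>\<close> is the error term $o_{n\to\infty}(1)$, uniform over all $n$-vertex hosts. Hosts
  with vertices of type \<^typ>\<open>nat\<close> represent every isomorphism class of finite 3-PDGs.
\<close>

definition asymptotic_bound :: "'a pdg3 \<Rightarrow> real \<Rightarrow> real \<Rightarrow> bool" where
  "asymptotic_bound F \<theta> c \<longleftrightarrow>
     (\<exists>\<epsilon> :: nat \<Rightarrow> real. \<epsilon> \<longlonglongrightarrow> 0 \<and>
        (\<forall>n. \<forall>H :: nat pdg3. is_pdg3 H \<and> card (verts H) = n \<and> pdg3_free F H \<longrightarrow>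
           undirected_density H + \<theta> * directed_density H \<le> c + \<epsilon> n))"

definition turan_density :: "'a pdg3 \<Rightarrow> real \<Rightarrow> real" where
  "turan_density F \<theta> = (LEAST c. asymptotic_bound F \<theta> c)"

definition T3 :: "nat pdg3" where
  "T3 = \<lparr>verts = {1, 2, 3, 4},
         status = (\<lambda>S. if S = {1, 2, 3} \<or> S = {2, 3, 4} then Undirected
                       else if S = {1, 2, 4} then Directed 4
                       else NoEdge)\<rparr>"

lemma is_pdg3_T3: "is_pdg3 T3"
  by (auto simp: is_pdg3_def T3_def split: if_splits)

end

theory Submission
  imports Defs "HOL-Library.Ramsey"
begin

text \<open>
  A 3-PDG is \<open>T3\<close>-free iff, in the link graph of every vertex \<open>v\<close>, no pair that forms with
  \<open>v\<close> an edge directed away from \<open>v\<close> lies in a triangle. In a graph on \<open>m\<close> vertices, the number of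
  edges plus the number of edges in no triangle is at most \<open>m\<^sup>2 / 2\<close>, by induction on \<open>m\<close>: at most
  \<open>m - 1\<close> edges meet a given edge in no triangle. Summed over all links, every undirected edge is
  counted 3 times and every directed edge 3 + 2 = 5 times, whence the weight 5/3. The complete
  undirected 3-graph shows that the bound is attained.
\<close>

section \<open>Edges in no triangle\<close>

definition edges_in_no_triangle :: "'a set set \<Rightarrow> 'a set set" where
  "edges_in_no_triangle E = {P \<in> E. \<nexists>x. \<forall>y\<in>P. {x, y} \<in> E}"

lemma edges_in_no_triangle_subset: "edges_in_no_triangle E \<subseteq> E"
  by (auto simp: edges_in_no_triangle_def)

lemma subset_edges_in_no_triangle_iff:
  "D \<subseteq> edges_in_no_triangle E \<longleftrightarrow> D \<subseteq> E \<and> (\<forall>P\<in>D. \<nexists>x. \<forall>y\<in>P. {x, y} \<in> E)"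
  by (simp add: edges_in_no_triangle_def subset_iff Ball_def imp_conjR all_conj_distrib)

lemma finite_edges_in_no_triangle: "finite E \<Longrightarrow> finite (edges_in_no_triangle E)"
  by (rule finite_subset[OF edges_in_no_triangle_subset])

lemma edges_in_no_triangle_Int_subset:
  "edges_in_no_triangle E \<inter> F \<subseteq> edges_in_no_triangle (E \<inter> F)"
  by (auto simp: edges_in_no_triangle_def)

lemma pair_meeting_pair_cases [consumes 3, case_names eq neq]:
  assumes "P \<in> [V]\<^bsup>2\<^esup>" "Q \<in> [V]\<^bsup>2\<^esup>" "Q \<inter> P \<noteq> {}"
  obtains "Q = P" | p q where "p \<in> P" "q \<in> V - P" "Q = {p, q}"
proof -
  obtain u v where "P = {u, v}" "u \<in> V" "v \<in> V" "u \<noteq> v"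
    using assms(1) by (rule nsets2_E)
  then have "Q = P \<or> (\<exists>p\<in>P. \<exists>q\<in>V - P. Q = {p, q})"
    using assms(2,3) by (fastforce simp: nsets_2_eq)
  then show thesis
    using that by blast
qed

text \<open>
  A vertex outside \<open>P\<close> is adjacent to at most one end of \<open>P\<close>, so an edge meeting \<open>P\<close> is determined
  by its part outside \<open>P\<close>.
\<close>
lemma inj_on_Diff_edge_in_no_triangle:
  assumes E: "E \<subseteq> [V]\<^bsup>2\<^esup>" and P: "P \<in> edges_in_no_triangle E"
  shows "inj_on (\<lambda>Q. Q - P) {Q \<in> E. Q \<inter> P \<noteq> {}}"
proof (rule inj_onI)
  fix Q R assume "Q \<in> {Q \<in> E. Q \<inter> P \<noteq> {}}" "R \<in> {Q \<in> E. Q \<inter> P \<noteq> {}}"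
  then have Q: "Q \<in> E" "Q \<inter> P \<noteq> {}" and R: "R \<in> E" "R \<inter> P \<noteq> {}"
    by simp_all
  have pairs: "P \<in> [V]\<^bsup>2\<^esup>" "Q \<in> [V]\<^bsup>2\<^esup>" "R \<in> [V]\<^bsup>2\<^esup>"
    using E P Q(1) R(1) edges_in_no_triangle_subset by auto
  assume Diff_eq: "Q - P = R - P"
  from pairs(1,2) Q(2) show "Q = R"
  proof (cases rule: pair_meeting_pair_cases)
    case eq
    from pairs(1,3) R(2) show ?thesis
      by (cases rule: pair_meeting_pair_cases) (use Diff_eq eq in auto)
  next
    case Q_neq: (neq p q)
    from pairs(1,3) R(2) show ?thesis
    proof (cases rule: pair_meeting_pair_cases)
      case eq
      then show ?thesis
        using Diff_eq Q_neq by auto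
    next
      case (neq p' q')
      then have "q = q'"
        using Diff_eq Q_neq by (auto simp: insert_Diff_if)
      moreover have "p = p'"
      proof (rule ccontr)
        assume "p \<noteq> p'"
        then have "P = {p, p'}"
          using pairs(1) Q_neq(1) neq(1) by (auto elim!: nsets2_E)
        then show False
          using P Q(1) R(1) Q_neq(3) neq(3) \<open>q = q'\<close>
          by (auto simp: edges_in_no_triangle_def insert_commute)
      qed
      ultimately show ?thesis
        using Q_neq neq by simp
    qed
  qed
qed

lemma card_edges_meeting_edge_in_no_triangle:
  assumes "finite V" "E \<subseteq> [V]\<^bsup>2\<^esup>" "P \<in> edges_in_no_triangle E"
  shows "card {Q \<in> E. Q \<inter> P \<noteq> {}} < card V"
proof -
  let ?M = "{Q \<in> E. Q \<inter> P \<noteq> {}}" and ?parts = "insert {} ((\<lambda>q. {q}) ` (V - P))"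
  have P: "P \<in> [V]\<^bsup>2\<^esup>"
    using assms(2,3) edges_in_no_triangle_subset by blast
  then have card_P: "P \<subseteq> V" "finite P" "card P = 2"
    by (simp_all add: nsets_def)
  have "Q - P \<in> ?parts" if "Q \<in> ?M" for Q
  proof -
    have "Q \<in> [V]\<^bsup>2\<^esup>" "Q \<inter> P \<noteq> {}"
      using that assms(2) by auto
    with P show ?thesis
      by (cases rule: pair_meeting_pair_cases) (auto simp: insert_Diff_if)
  qed
  then have "card ?M \<le> card ?parts"
    using inj_on_Diff_edge_in_no_triangle[OF assms(2,3)] assms(1)
    by (intro card_inj_on_le) auto
  also have "\<dots> = Suc (card (V - P))"
    using assms(1) by (subst card_insert_disjoint) (auto simp: card_image)
  also have "card (V - P) = card V - 2"
    using card_P by (simp add: card_Diff_subset)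
  finally show ?thesis
    using card_mono[OF assms(1) card_P(1)] card_P(3) by simp
qed

lemma two_card_edges_le:
  assumes "finite V" "E \<subseteq> [V]\<^bsup>2\<^esup>"
  shows "2 * card E \<le> (card V)\<^sup>2"
proof -
  have "card E \<le> card V choose 2"
    using card_mono[OF finite_imp_finite_nsets[OF assms(1)] assms(2)] by simp
  then have "2 * card E \<le> card V * (card V - 1)"
    by (simp add: choose_two)
  also have "\<dots> \<le> (card V)\<^sup>2"
    by (simp add: power2_eq_square)
  finally show ?thesis .
qed

lemma card_edges_delete_edge_in_no_triangle:
  assumes "finite V" "E \<subseteq> [V]\<^bsup>2\<^esup>" "P \<in> edges_in_no_triangle E"
  shows "card E + card (edges_in_no_triangle E) + 2 \<le>
    card {Q \<in> E. Q \<inter> P = {}} + card (edges_in_no_triangle {Q \<in> E. Q \<inter> P = {}}) + 2 * card V"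
proof -
  let ?N = edges_in_no_triangle and ?A = "{Q. Q \<inter> P = {}}"
  have fin: "finite E" "finite (?N E)" "finite (?N (E \<inter> ?A))"
    using finite_subset[OF assms(2) finite_imp_finite_nsets[OF assms(1)]]
    by (simp_all add: finite_edges_in_no_triangle)
  have split: "card F = card (F \<inter> ?A) + card (F - ?A)" if "finite F" for F
    using that by (rule card_Int_Diff)
  have "E - ?A = {Q \<in> E. Q \<inter> P \<noteq> {}}"
    by blast
  then have "card (E - ?A) < card V"
    using card_edges_meeting_edge_in_no_triangle[OF assms] by simp
  moreover have "card (?N E - ?A) \<le> card (E - ?A)"
    using edges_in_no_triangle_subset[of E] fin(1) by (intro card_mono) auto
  moreover have "card (?N E \<inter> ?A) \<le> card (?N (E \<inter> ?A))"
    using edges_in_no_triangle_Int_subset[of E ?A] fin(3) by (intro card_mono) auto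
  ultimately have "card E + card (?N E) + 2 \<le> card (E \<inter> ?A) + card (?N (E \<inter> ?A)) + 2 * card V"
    using split[OF fin(1)] split[OF fin(2)] by linarith
  then show ?thesis
    by (simp add: Int_def)
qed

lemma card_edges_plus_card_edges_in_no_triangle_le:
  assumes "finite V" "E \<subseteq> [V]\<^bsup>2\<^esup>"
  shows "2 * (card E + card (edges_in_no_triangle E)) \<le> (card V)\<^sup>2"
  using assms
proof (induction V arbitrary: E rule: finite_psubset_induct)
  case (psubset V)
  show ?case
  proof (cases "edges_in_no_triangle E = {}")
    case True
    then show ?thesis
      using two_card_edges_le[OF psubset.hyps psubset.prems] by simp
  next
    case False
    then obtain P where P: "P \<in> edges_in_no_triangle E"
      by blast
    then have "P \<in> [V]\<^bsup>2\<^esup>"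
      using psubset.prems edges_in_no_triangle_subset by blast
    then have PV: "P \<subseteq> V" "finite P" "card P = 2"
      by (simp_all add: nsets_def)
    then have card_V: "card V = card (V - P) + 2"
      using psubset.hyps card_mono[of V P] by (simp add: card_Diff_subset)
    let ?E' = "{Q \<in> E. Q \<inter> P = {}}"
    have "2 * (card ?E' + card (edges_in_no_triangle ?E')) \<le> (card (V - P))\<^sup>2"
    proof (rule psubset.IH)
      show "V - P \<subset> V"
        using PV by (auto simp: card_2_iff)
      show "?E' \<subseteq> [V - P]\<^bsup>2\<^esup>"
        using psubset.prems by (auto simp: nsets_def)
    qed
    then have "2 * (card E + card (edges_in_no_triangle E)) \<le>
        (card (V - P))\<^sup>2 + 4 * (card (V - P) + 1)"
      using card_edges_delete_edge_in_no_triangle[OF psubset.hyps psubset.prems P] card_V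
      by (simp add: algebra_simps)
    also have "\<dots> = (card V)\<^sup>2"
      unfolding card_V by (simp add: power2_eq_square algebra_simps)
    finally show ?thesis .
  qed
qed

section \<open>Subgraphs as embeddings\<close>

definition status_le :: "'a edge_status \<Rightarrow> 'a edge_status \<Rightarrow> bool" where
  "status_le s t \<longleftrightarrow> s = NoEdge \<or> s = t \<or> s = Undirected \<and> t \<noteq> NoEdge"

lemma status_le_simps [simp]:
  "status_le NoEdge t"
  "status_le Undirected t \<longleftrightarrow> t \<noteq> NoEdge"
  "status_le (Directed v) t \<longleftrightarrow> t = Directed v"
  by (auto simp: status_le_def)

definition pdg3_embedding :: "('a \<Rightarrow> 'b) \<Rightarrow> 'a pdg3 \<Rightarrow> 'b pdg3 \<Rightarrow> bool" where
  "pdg3_embedding f F H \<longleftrightarrow> inj_on f (verts F) \<and> f ` verts F \<subseteq> verts H \<and>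
     (\<forall>S\<in>triples F. status_le (map_edge_status f (status F S)) (status H (f ` S)))"

lemma verts_reductions [simp]:
  "verts (delete_vertices X H) = verts H - X"
  "verts (delete_edges A H) = verts H"
  "verts (forget_directions B H) = verts H"
  by (simp_all add: delete_vertices_def delete_edges_def forget_directions_def)

lemma status_reduction:
  "status (forget_directions B (delete_edges A (delete_vertices X H))) S =
    (if S \<in> A then NoEdge
     else case status H S of Directed v \<Rightarrow> if S \<in> B then Undirected else Directed v | s \<Rightarrow> s)"
  by (simp add: delete_vertices_def delete_edges_def forget_directions_def)

lemma pdg3_embedding_if_subgraph:
  assumes "pdg3_subgraph F H"
  obtains f where "pdg3_embedding f F H"
proof -
  obtain X A B f
    where f: "bij_betw f (verts F) (verts H - X)"
      and status: "\<forall>S\<in>triples F.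
        status (forget_directions B (delete_edges A (delete_vertices X H))) (f ` S) =
        map_edge_status f (status F S)"
    using assms unfolding pdg3_subgraph_def pdg3_iso_def verts_reductions by blast
  have reduction_le: "status_le
      (status (forget_directions B (delete_edges A (delete_vertices X H))) S)
      (status H S)" for S
    by (auto simp: status_le_def status_reduction split: edge_status.split)
  have "status_le (map_edge_status f (status F S)) (status H (f ` S))" if "S \<in> triples F" for S
    using reduction_le[of "f ` S"] status that by simp
  then have "pdg3_embedding f F H"
    using f by (auto simp: pdg3_embedding_def bij_betw_def)
  then show thesis
    by (rule that)
qed

lemma pdg3_subgraph_if_embedding:
  assumes "pdg3_embedding f F H"
  shows "pdg3_subgraph F H"
proof -
  have inj: "inj_on f (verts F)" and verts: "f ` verts F \<subseteq> verts H"
    and status_image: "\<And>S. S \<in> triples F \<Longrightarrow>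
      status_le (map_edge_status f (status F S)) (status H (f ` S))"
    using assms by (auto simp: pdg3_embedding_def)
  define X where "X = - f ` verts F"
  define A where "A = image f ` {S \<in> triples F. status F S = NoEdge}"
  define B where "B = image f ` {S \<in> triples F. status F S = Undirected}"
  have "inj_on (image f) (triples F)"
    using inj_on_image_Pow[OF inj] by (rule inj_on_subset) (auto simp: triples_def)
  then have mem_iff: "f ` S \<in> A \<longleftrightarrow> status F S = NoEdge" "f ` S \<in> B \<longleftrightarrow> status F S = Undirected"
    if "S \<in> triples F" for S
    using that by (auto simp: A_def B_def dest: inj_onD)
  have "status (forget_directions B (delete_edges A (delete_vertices X H))) (f ` S) =
      map_edge_status f (status F S)" if "S \<in> triples F" for S
    using status_image[OF that] mem_iff[OF that]
    by (cases "status F S") (auto simp: status_le_def status_reduction split: edge_status.split)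
  moreover have "bij_betw f (verts F) (verts H - X)"
    using inj verts by (auto simp: bij_betw_def X_def)
  ultimately show ?thesis
    unfolding pdg3_subgraph_def pdg3_iso_def verts_reductions by blast
qed

lemma pdg3_subgraph_iff_embedding: "pdg3_subgraph F H \<longleftrightarrow> (\<exists>f. pdg3_embedding f F H)"
  using pdg3_embedding_if_subgraph pdg3_subgraph_if_embedding by metis

lemma triples_eq_nsets: "triples H = [verts H]\<^bsup>3\<^esup>"
  by (auto simp: triples_def nsets_def intro: card_ge_0_finite)

lemma verts_T3: "verts T3 = {1, 2, 3, 4}"
  by (simp add: T3_def)

lemma triples_T3: "triples T3 = {{1, 2, 3}, {2, 3, 4}, {1, 2, 4}, {1, 3, 4}}"
  by (simp add: triples_eq_nsets nsets_3_eq verts_T3 insert_Diff_if insert_commute)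

lemma status_T3:
  "status T3 {1, 2, 3} = Undirected" "status T3 {2, 3, 4} = Undirected"
  "status T3 {1, 2, 4} = Directed 4" "status T3 {1, 3, 4} = NoEdge"
  by (simp_all add: T3_def set_eq_subset)

lemma pdg3_subgraph_T3_iff:
  "pdg3_subgraph T3 H \<longleftrightarrow>
     (\<exists>a b c d. distinct [a, b, c, d] \<and> {a, b, c, d} \<subseteq> verts H \<and>
        status H {a, b, c} \<noteq> NoEdge \<and> status H {b, c, d} \<noteq> NoEdge \<and>
        status H {a, b, d} = Directed d)"
    (is "_ \<longleftrightarrow> (\<exists>a b c d. ?copy a b c d)")
proof -
  have embedding_iff: "pdg3_embedding f T3 H \<longleftrightarrow> ?copy (f 1) (f 2) (f 3) (f 4)" for f
    by (simp add: pdg3_embedding_def triples_T3 status_T3 verts_T3 insert_Diff_if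
        del: One_nat_def) blast
  show ?thesis
  proof
    assume "pdg3_subgraph T3 H"
    then show "\<exists>a b c d. ?copy a b c d"
      unfolding pdg3_subgraph_iff_embedding embedding_iff by blast
  next
    assume "\<exists>a b c d. ?copy a b c d"
    then obtain a b c d where "?copy a b c d" by blast
    then have "pdg3_embedding
        (\<lambda>i. if i = 1 then a else if i = 2 then b else if i = 3 then c else d) T3 H"
      unfolding embedding_iff by simp
    then show "pdg3_subgraph T3 H"
      unfolding pdg3_subgraph_iff_embedding by blast
  qed
qed

section \<open>Links\<close>

definition link :: "'a pdg3 \<Rightarrow> 'a \<Rightarrow> 'a set set" where
  "link H v = {P \<in> [verts H - {v}]\<^bsup>2\<^esup>. status H (insert v P) \<noteq> NoEdge}"

definition out_link :: "'a pdg3 \<Rightarrow> 'a \<Rightarrow> 'a set set" where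
  "out_link H v = {P \<in> [verts H - {v}]\<^bsup>2\<^esup>. \<exists>w\<in>P. status H (insert v P) = Directed w}"

lemma out_link_subset_link: "out_link H v \<subseteq> link H v"
  by (auto simp: link_def out_link_def)

lemma pdg3_subgraph_T3_iff_links:
  "pdg3_subgraph T3 H \<longleftrightarrow> (\<exists>v\<in>verts H. \<exists>P\<in>out_link H v. \<exists>x. \<forall>y\<in>P. {x, y} \<in> link H v)"
proof
  assume "pdg3_subgraph T3 H"
  then obtain a b c d where "distinct [a, b, c, d]" "{a, b, c, d} \<subseteq> verts H"
    "status H {a, b, c} \<noteq> NoEdge" "status H {b, c, d} \<noteq> NoEdge" "status H {a, b, d} = Directed d"
    unfolding pdg3_subgraph_T3_iff by blast
  then have "b \<in> verts H" "{a, d} \<in> out_link H b" "{c, a} \<in> link H b" "{c, d} \<in> link H b"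
    by (auto simp: link_def out_link_def insert_commute)
  then show "\<exists>v\<in>verts H. \<exists>P\<in>out_link H v. \<exists>x. \<forall>y\<in>P. {x, y} \<in> link H v"
    by (intro bexI[of _ b] bexI[of _ "{a, d}"] exI[of _ c]) simp_all
next
  assume "\<exists>v\<in>verts H. \<exists>P\<in>out_link H v. \<exists>x. \<forall>y\<in>P. {x, y} \<in> link H v"
  then obtain v P x where v_out: "v \<in> verts H" "P \<in> out_link H v"
    and x_adj: "\<forall>y\<in>P. {x, y} \<in> link H v"
    by blast
  from v_out(2) obtain w where head: "w \<in> P" "status H (insert v P) = Directed w"
    and "P \<in> [verts H - {v}]\<^bsup>2\<^esup>"
    by (auto simp: out_link_def)
  then obtain a where "P = {a, w}" "a \<noteq> w"
    by (auto elim!: nsets2_E)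
  then have "distinct [a, v, x, w] \<and> {a, v, x, w} \<subseteq> verts H \<and> status H {a, v, x} \<noteq> NoEdge \<and>
      status H {v, x, w} \<noteq> NoEdge \<and> status H {a, v, w} = Directed w"
    using v_out(1) head x_adj by (auto simp: link_def insert_commute)
  then show "pdg3_subgraph T3 H"
    unfolding pdg3_subgraph_T3_iff by blast
qed

lemma pdg3_free_T3_iff:
  "pdg3_free T3 H \<longleftrightarrow> (\<forall>v\<in>verts H. out_link H v \<subseteq> edges_in_no_triangle (link H v))"
  by (simp add: pdg3_free_def pdg3_subgraph_T3_iff_links subset_edges_in_no_triangle_iff
      out_link_subset_link)

lemma sum_card_nsets_insert:
  assumes "finite V"
  shows "(\<Sum>v\<in>V. card {P \<in> [V - {v}]\<^bsup>k\<^esup>. R v (insert v P)}) = (\<Sum>S\<in>[V]\<^bsup>Suc k\<^esup>. card {v \<in> S. R v S})"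
proof -
  have "bij_betw (\<lambda>(v, P). (insert v P, v))
      (SIGMA v:V. {P \<in> [V - {v}]\<^bsup>k\<^esup>. R v (insert v P)}) (SIGMA S:[V]\<^bsup>Suc k\<^esup>. {v \<in> S. R v S})"
    by (rule bij_betw_byWitness[where f' = "\<lambda>(S, v). (v, S - {v})"])
      (auto simp: nsets_def insert_absorb card_insert_if)
  then have "card (SIGMA v:V. {P \<in> [V - {v}]\<^bsup>k\<^esup>. R v (insert v P)}) =
      card (SIGMA S:[V]\<^bsup>Suc k\<^esup>. {v \<in> S. R v S})"
    by (rule bij_betw_same_card)
  then show ?thesis
    using assms by (subst (asm) (1 2) card_SigmaI) (auto simp: finite_imp_finite_nsets nsets_def)
qed

lemma finite_triples: "finite (verts H) \<Longrightarrow> finite (triples H)"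
  by (simp add: triples_eq_nsets finite_imp_finite_nsets)

lemma undirected_edges_Un_directed_edges:
  "undirected_edges H \<union> directed_edges H = {S \<in> triples H. status H S \<noteq> NoEdge}"
proof (rule set_eqI)
  fix S
  show "S \<in> undirected_edges H \<union> directed_edges H \<longleftrightarrow>
      S \<in> {S \<in> triples H. status H S \<noteq> NoEdge}"
    by (cases "status H S") (auto simp: undirected_edges_def directed_edges_def)
qed

lemma sum_card_link:
  assumes "finite (verts H)"
  shows "(\<Sum>v\<in>verts H. card (link H v)) = 3 * (card (undirected_edges H) + card (directed_edges H))"
proof -
  have fin: "finite (triples H)"
    using assms by (rule finite_triples)
  have "(\<Sum>v\<in>verts H. card (link H v)) = (\<Sum>S\<in>triples H. card {v \<in> S. status H S \<noteq> NoEdge})"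
    using sum_card_nsets_insert[OF assms, of 2 "\<lambda>v S. status H S \<noteq> NoEdge"]
    by (simp add: link_def triples_eq_nsets)
  also have "\<dots> = (\<Sum>S | S \<in> triples H \<and> status H S \<noteq> NoEdge. 3)"
    by (rule sum.mono_neutral_cong_right[OF fin]) (auto simp: triples_def)
  also have "\<dots> = 3 * card (undirected_edges H \<union> directed_edges H)"
    by (simp add: undirected_edges_Un_directed_edges)
  also have "card (undirected_edges H \<union> directed_edges H) =
      card (undirected_edges H) + card (directed_edges H)"
    using fin by (intro card_Un_disjoint) (auto simp: undirected_edges_def directed_edges_def)
  finally show ?thesis .
qed

lemma sum_card_out_link:
  assumes "is_pdg3 H"
  shows "(\<Sum>v\<in>verts H. card (out_link H v)) = 2 * card (directed_edges H)"
proof -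
  have fin: "finite (verts H)"
    using assms by (simp add: is_pdg3_def)
  have "out_link H v = {P \<in> [verts H - {v}]\<^bsup>2\<^esup>.
      \<exists>w\<in>insert v P - {v}. status H (insert v P) = Directed w}" for v
    by (auto simp: out_link_def nsets_def)
  then have "(\<Sum>v\<in>verts H. card (out_link H v)) =
      (\<Sum>S\<in>triples H. card {v \<in> S. \<exists>w\<in>S - {v}. status H S = Directed w})"
    using sum_card_nsets_insert[OF fin, of 2 "\<lambda>v S. \<exists>w\<in>S - {v}. status H S = Directed w"]
    by (simp add: triples_eq_nsets)
  also have "\<dots> = (\<Sum>S\<in>directed_edges H. 2)"
  proof (rule sum.mono_neutral_cong_right[OF finite_triples[OF fin]])
    show "directed_edges H \<subseteq> triples H"
      by (auto simp: directed_edges_def)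
    show "\<forall>S\<in>triples H - directed_edges H. card {v \<in> S. \<exists>w\<in>S - {v}. status H S = Directed w} = 0"
      by (auto simp: directed_edges_def)
    fix S assume "S \<in> directed_edges H"
    then obtain w where S: "S \<in> triples H" "status H S = Directed w"
      by (auto simp: directed_edges_def)
    then have "w \<in> S"
      using assms by (simp add: is_pdg3_def)
    moreover from this have "{v \<in> S. \<exists>w\<in>S - {v}. status H S = Directed w} = S - {w}"
      using S by auto
    ultimately show "card {v \<in> S. \<exists>w\<in>S - {v}. status H S = Directed w} = 2"
      using S by (simp add: triples_def)
  qed
  finally show ?thesis
    by simp
qed

lemma T3_free_card_edges_le:
  assumes "is_pdg3 H" "pdg3_free T3 H"
  shows "2 * (3 * card (undirected_edges H) + 5 * card (directed_edges H))
    \<le> card (verts H) * (card (verts H) - 1)\<^sup>2"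
proof -
  have fin: "finite (verts H)"
    using assms(1) by (simp add: is_pdg3_def)
  have link_bound: "2 * (card (link H v) + card (out_link H v)) \<le> (card (verts H) - 1)\<^sup>2"
    if v: "v \<in> verts H" for v
  proof -
    have link: "link H v \<subseteq> [verts H - {v}]\<^bsup>2\<^esup>"
      by (auto simp: link_def)
    then have "finite (edges_in_no_triangle (link H v))"
      using fin
      by (meson finite_Diff finite_edges_in_no_triangle finite_imp_finite_nsets finite_subset)
    then have "card (out_link H v) \<le> card (edges_in_no_triangle (link H v))"
      using assms(2) v by (auto simp: pdg3_free_T3_iff intro: card_mono)
    then show ?thesis
      using card_edges_plus_card_edges_in_no_triangle_le[OF _ link] fin v by simp
  qed
  have "2 * (3 * card (undirected_edges H) + 5 * card (directed_edges H)) =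
      (\<Sum>v\<in>verts H. 2 * (card (link H v) + card (out_link H v)))"
    using sum_card_link[OF fin] sum_card_out_link[OF assms(1)]
    by (simp add: sum.distrib flip: sum_distrib_left)
  also have "\<dots> \<le> (\<Sum>v\<in>verts H. (card (verts H) - 1)\<^sup>2)"
    using link_bound by (rule sum_mono)
  finally show ?thesis
    by simp
qed

section \<open>Densities\<close>

lemma real_choose_three: "real (n choose 3) = real n * (real n - 1) * (real n - 2) / 6"
  by (simp add: binomial_gbinomial gbinomial_prod_rev numeral_3_eq_3 lessThan_Suc algebra_simps)

lemma T3_free_density_le:
  assumes "is_pdg3 H" "pdg3_free T3 H" and card_verts: "n = card (verts H)" "3 \<le> n"
  shows "undirected_density H + 5 / 3 * directed_density H \<le> 1 + 1 / (real n - 2)"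
proof -
  let ?u = "real (card (undirected_edges H))" and ?d = "real (card (directed_edges H))"
  have "real (2 * (3 * card (undirected_edges H) + 5 * card (directed_edges H)))
      \<le> real (n * (n - 1)\<^sup>2)"
    using T3_free_card_edges_le[OF assms(1,2)] card_verts(1) by (intro of_nat_mono) simp
  then have "?u + 5 / 3 * ?d \<le> real n * (real n - 1)\<^sup>2 / 6"
    using card_verts(2) by simp
  also have "\<dots> = (1 + 1 / (real n - 2)) * real (n choose 3)"
    using card_verts(2) unfolding real_choose_three by (simp add: field_simps power2_eq_square)
  finally have "(?u + 5 / 3 * ?d) / real (n choose 3) \<le> 1 + 1 / (real n - 2)"
    using card_verts(2) by (simp add: pos_divide_le_eq)
  then show ?thesis
    using card_verts(1)
    by (simp add: undirected_density_def directed_density_def add_divide_distrib)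
qed

lemma asymptotic_bound_T3: "asymptotic_bound T3 (5 / 3) 1"
proof -
  have "undirected_density H + 5 / 3 * directed_density H \<le> 1 + 1 / (real (card (verts H)) - 2)"
    if "is_pdg3 H" "pdg3_free T3 H" for H :: "nat pdg3"
  proof (cases "card (verts H) < 3")
    case True
    \<comment> \<open>Both densities are fractions with denominator 0.\<close>
    then have "undirected_density H = 0" "directed_density H = 0"
      by (simp_all add: undirected_density_def directed_density_def)
    moreover have "card (verts H) \<in> {0, 1, 2}"
      using True by auto
    ultimately show ?thesis by auto
  next
    case False
    then show ?thesis
      using T3_free_density_le[OF that refl] by simp
  qed
  moreover have "(\<lambda>n. 1 / (real n - 2)) \<longlonglongrightarrow> 0"
    by (rule LIMSEQ_offset[of _ 2]) (simp add: lim_1_over_n)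
  ultimately show ?thesis
    unfolding asymptotic_bound_def by blast
qed

definition complete_pdg3 :: "'a set \<Rightarrow> 'a pdg3" where
  "complete_pdg3 V = \<lparr>verts = V, status = (\<lambda>_. Undirected)\<rparr>"

lemma pdg3_free_complete_pdg3:
  assumes "directed_edges F \<noteq> {}"
  shows "pdg3_free F (complete_pdg3 V)"
proof -
  obtain S v where S: "S \<in> triples F" "status F S = Directed v"
    using assms by (auto simp: directed_edges_def)
  have "\<not> pdg3_embedding f F (complete_pdg3 V)" for f
    using S by (force simp: pdg3_embedding_def status_le_def complete_pdg3_def)
  then show ?thesis
    by (simp add: pdg3_free_def pdg3_subgraph_iff_embedding)
qed

lemma density_complete_pdg3:
  assumes "finite V"
  shows "3 \<le> card V \<Longrightarrow> undirected_density (complete_pdg3 V) = 1"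
    and "directed_density (complete_pdg3 V) = 0"
  using n_subsets[OF assms, of 3]
  by (simp_all add: undirected_density_def directed_density_def undirected_edges_def
      directed_edges_def triples_def complete_pdg3_def)

lemma asymptotic_bound_ge_1:
  assumes "asymptotic_bound F \<theta> c" "directed_edges F \<noteq> {}"
  shows "1 \<le> c"
proof -
  obtain \<epsilon> :: "nat \<Rightarrow> real" where lim: "\<epsilon> \<longlonglongrightarrow> 0" and
    bound: "\<And>H :: nat pdg3. \<lbrakk>is_pdg3 H; pdg3_free F H\<rbrakk> \<Longrightarrow>
      undirected_density H + \<theta> * directed_density H \<le> c + \<epsilon> (card (verts H))"
    using assms(1) unfolding asymptotic_bound_def by blast
  have "1 \<le> c + \<epsilon> n" if "n \<ge> 3" for n
  proof -
    have "is_pdg3 (complete_pdg3 {..<n})"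
      by (simp add: is_pdg3_def complete_pdg3_def)
    then show ?thesis
      using bound[OF _ pdg3_free_complete_pdg3[OF assms(2)], of "{..<n}"] that
      by (simp add: density_complete_pdg3) (simp add: complete_pdg3_def)
  qed
  then have "1 \<le> c + 0"
    by (intro LIMSEQ_le_const[OF tendsto_add[OF tendsto_const lim]]) blast
  then show ?thesis by simp
qed

theorem theorem2p3: "turan_density T3 (5 / 3) = 1"
  unfolding turan_density_def
proof (rule Least_equality)
  show "asymptotic_bound T3 (5 / 3) 1"
    by (rule asymptotic_bound_T3)
  have "{1, 2, 4} \<in> directed_edges T3"
    by (simp add: directed_edges_def triples_T3 status_T3 del: One_nat_def)
  then show "1 \<le> c" if "asymptotic_bound T3 (5 / 3) c" for c
    using asymptotic_bound_ge_1[OF that] by blast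
qed

end
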